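(* Let $\vec{G}$ and $\vec{H}$ be (nonempty) linearly ordered graphs. The characteristic polynomial of the skew-adjacency matrix of the join $\vec{G}\vec{\nabla}\vec{H}$ is given by $$\vec{P}_{\vec{G}\vec{\nabla}\vec{H}}(x)=\vec{P}_{\vec{G}}(x)\vec{P}_{\vec{H}}(x)+\bigl(\vec{P}_{K_1\vec{\nabla}\vec{G}}(x)-x\vec{P}_{\vec{G}}(x)\bigr)\bigl(\vec{P}_{K_1\vec{\nabla}\vec{H}}(x)-x\vec{P}_{\vec{H}}(x)\bigr).$$
   Context: A linearly ordered graph $\vec{G}$ is a finite simple graph whose vertices are labelled $1,\ldots,n$ (the label of $w$ is $l(w)$), with each edge directed from the vertex with the smaller label to the vertex with the larger label. Its skew-adjacency matrix $\vec{A}_{\vec{G}}$ has $(i,j)$ entry $1$ if $i,j$ are adjacent and $i<j$, $-1$ if $i,j$ are adjacent and $i>j$, and $0$ otherwise; $\vec{P}_{\vec{G}}(x)=\det(xI-\vec{A}_{\vec{G}})$. If $\vec{G}_1,\vec{G}_2$ are linearly ordered graphs with $n_1,n_2$ vertices, the join $\vec{G}_1\vec{\nabla}\vec{G}_2$ is obtained by taking the disjoint union, relabelling every vertex $v$ of $\vec{G}_2$ by $l(v)+n_1$ (vertices of $\vec{G}_1$ keep their labels), and connecting every vertex of $\vec{G}_1$ with every vertex of $\vec{G}_2$, the new edges being directed from $\vec{G}_1$ to $\vec{G}_2$. $K_1$ is the one-vertex graph (labelled $1$). *)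

theory Defs
  imports "Jordan_Normal_Form.Char_Poly"
begin

record 'v ordered_graph =
  verts :: "'v set"
  arcs :: "('v \<times> 'v) set"
  label :: "'v \<Rightarrow> nat"

text \<open>The graph is represented by its directed edges. Since arcs strictly increase the label,
  there are neither loops nor pairs of opposite arcs, so the underlying undirected graph is simple
  and its edges correspond one-to-one to the arcs.\<close>

definition linearly_ordered_graph :: "'v ordered_graph \<Rightarrow> bool" where
  "linearly_ordered_graph G \<longleftrightarrow>
     finite (verts G) \<and>
     arcs G \<subseteq> verts G \<times> verts G \<and>
     bij_betw (label G) (verts G) {1..card (verts G)} \<and>
     (\<forall>(u, v) \<in> arcs G. label G u < label G v)"

definition adjacent :: "'v ordered_graph \<Rightarrow> 'v \<Rightarrow> 'v \<Rightarrow> bool" where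
  "adjacent G u v \<longleftrightarrow> (u, v) \<in> arcs G \<or> (v, u) \<in> arcs G"

definition vertex_of :: "'v ordered_graph \<Rightarrow> nat \<Rightarrow> 'v" where
  "vertex_of G i = the_inv_into (verts G) (label G) i"

text \<open>Matrix indices start at 0 and labels at 1, hence the shift by \<open>Suc\<close>.\<close>

definition skew_adjacency_matrix :: "'v ordered_graph \<Rightarrow> real mat" where
  "skew_adjacency_matrix G = mat (card (verts G)) (card (verts G))
     (\<lambda>(i, j). if adjacent G (vertex_of G (Suc i)) (vertex_of G (Suc j))
                then if i < j then 1 else if i > j then - 1 else 0
                else 0)"

definition skew_char_poly :: "'v ordered_graph \<Rightarrow> real poly" where
  "skew_char_poly G = char_poly (skew_adjacency_matrix G)"

definition ordered_join :: "'a ordered_graph \<Rightarrow> 'b ordered_graph \<Rightarrow> ('a + 'b) ordered_graph" where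
  "ordered_join G H =
     \<lparr>verts = verts G <+> verts H,
      arcs = map_prod Inl Inl ` arcs G \<union> map_prod Inr Inr ` arcs H
               \<union> (Inl ` verts G) \<times> (Inr ` verts H),
      label = case_sum (label G) (\<lambda>v. label H v + card (verts G))\<rparr>"

definition K1 :: "unit ordered_graph" where
  "K1 = \<lparr>verts = {()}, arcs = {}, label = (\<lambda>_. 1)\<rparr>"

lemma linearly_ordered_graph_K1: "linearly_ordered_graph K1"
  by (auto simp: linearly_ordered_graph_def K1_def bij_betw_def)

lemma linearly_ordered_graph_join:
  assumes "linearly_ordered_graph G" and "linearly_ordered_graph H"
  shows "linearly_ordered_graph (ordered_join G H)"
proof -
  let ?J = "ordered_join G H" and ?m = "card (verts G)" and ?n = "card (verts H)"
  have fin: "finite (verts G)" "finite (verts H)"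
    and sub: "arcs G \<subseteq> verts G \<times> verts G" "arcs H \<subseteq> verts H \<times> verts H"
    and bij: "bij_betw (label G) (verts G) {1..?m}" "bij_betw (label H) (verts H) {1..?n}"
    and mono: "\<And>u v. (u, v) \<in> arcs G \<Longrightarrow> label G u < label G v"
      "\<And>u v. (u, v) \<in> arcs H \<Longrightarrow> label H u < label H v"
    using assms by (auto simp: linearly_ordered_graph_def)
  have G: "\<And>u. u \<in> verts G \<Longrightarrow> 1 \<le> label G u \<and> label G u \<le> ?m"
    and H: "\<And>v. v \<in> verts H \<Longrightarrow> 1 \<le> label H v \<and> label H v \<le> ?n"
    using bij by (auto simp: bij_betw_def)
  have card: "card (verts ?J) = ?m + ?n"
    using fin by (simp add: ordered_join_def card_Plus)
  have inj: "inj_on (label ?J) (verts ?J)"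
  proof (rule inj_onI)
    fix x y assume "x \<in> verts ?J" "y \<in> verts ?J" "label ?J x = label ?J y"
    then show "x = y"
      using bij G H
      by (auto simp: ordered_join_def bij_betw_def dest: inj_onD) (fastforce dest: G H)+
  qed
  have "label ?J ` verts ?J \<subseteq> {1..?m + ?n}"
    using G H by (fastforce simp: ordered_join_def)
  then have "label ?J ` verts ?J = {1..?m + ?n}"
    using inj card by (intro card_subset_eq) (auto simp: card_image)
  moreover have "label ?J u < label ?J v" if "(u, v) \<in> arcs ?J" for u v
    using that mono G H by (fastforce simp: ordered_join_def)
  moreover have "arcs ?J \<subseteq> verts ?J \<times> verts ?J" "finite (verts ?J)"
    using sub fin by (auto simp: ordered_join_def)
  ultimately show ?thesis
    using inj card by (auto simp: linearly_ordered_graph_def bij_betw_def)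
qed

end

theory Submission
  imports Defs
begin

text \<open>
  Write \<open>M = xI - A\<close> and \<open>N = xI - B\<close>, where \<open>A\<close> and \<open>B\<close> are the skew-adjacency matrices of \<open>G\<close> and
  \<open>H\<close>, and let \<open>J\<close> be the all-ones matrix of the appropriate shape. The vertices of \<open>G\<close> precede those
  of \<open>H\<close> in the join and all arcs in between point from \<open>G\<close> to \<open>H\<close>, so the characteristic matrix of
  the join is the block matrix with rows \<open>(M, -J)\<close> and \<open>(J, N)\<close>. The off-diagonal blocks have rank
  one, and therefore \<open>G\<close> and \<open>H\<close> influence each other only through one number each. For invertible
  \<open>M\<close> and \<open>N\<close> these numbers are the sums \<open>s\<close> and \<open>t\<close> of all entries of the inverses of \<open>M\<close> and \<open>N\<close>
  (in graph theory, \<open>s\<close> is known as the coronal of \<open>A\<close>): eliminating one diagonal block after the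
  other (lemmas \<open>det_four_block_Schur_upper\<close> and \<open>det_four_block_Schur_lower\<close>) yields
  \<open>det M * det N * (1 + s * t)\<close>, which is lemma \<open>det_four_block_const\<close>.

  Joining a single vertex in front of \<open>G\<close> is the instance where the first block is the \<open>1\<close> by \<open>1\<close>
  matrix \<open>x\<close>. It gives \<open>det M * (x + s)\<close>, so the join with \<open>K1\<close> reads off exactly the missing datum:
  subtracting \<open>x * det M\<close> leaves \<open>s * det M\<close>, and the product of the two such differences for \<open>G\<close>
  and \<open>H\<close> is \<open>det M * det N * s * t\<close>.

  This proves the identity at every real \<open>x\<close> that is a root of neither \<open>skew_char_poly G\<close> nor
  \<open>skew_char_poly H\<close>. Both are monic, so only finitely many points are left out and the two sides
  agree as polynomials.
\<close>

section \<open>Determinants of block matrices with an invertible diagonal block\<close>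

lemma add_minus_cancel_mat:
  fixes X :: "'a :: ab_group_add mat"
  assumes "X \<in> carrier_mat m n" and "Y \<in> carrier_mat m n"
  shows "X + (Y - X) = Y"
  using assms by (auto intro!: eq_matI)

lemma minus_add_cancel_mat:
  fixes X :: "'a :: ab_group_add mat"
  assumes "X \<in> carrier_mat m n" and "Y \<in> carrier_mat m n"
  shows "Y - X + X = Y"
  using assms by (auto intro!: eq_matI)

text \<open>Block elimination: the matrix is the product of a block lower triangular matrix
  \<open>?L\<close> with diagonal blocks \<open>A\<close> and the Schur complement of \<open>A\<close>, and a block upper
  unitriangular matrix \<open>?R\<close>.\<close>

lemma det_four_block_Schur_upper:
  fixes A :: "'a :: idom mat"
  assumes A: "A \<in> carrier_mat m m" and B: "B \<in> carrier_mat m n"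
    and C: "C \<in> carrier_mat n m" and D: "D \<in> carrier_mat n n"
    and Ai: "Ai \<in> carrier_mat m m" and inv: "A * Ai = 1\<^sub>m m"
  shows "det (four_block_mat A B C D) = det A * det (D - C * Ai * B)"
proof -
  let ?L = "four_block_mat A (0\<^sub>m m n) C (D - C * Ai * B)"
  let ?R = "four_block_mat (1\<^sub>m m) (Ai * B) (0\<^sub>m n m) (1\<^sub>m n)"
  have CAB: "C * Ai * B \<in> carrier_mat n n"
    using B C Ai by auto
  have S: "D - C * Ai * B \<in> carrier_mat n n"
    using CAB by (rule minus_carrier_mat)
  have 1: "A * (Ai * B) = B"
    using assoc_mult_mat[OF A Ai B] inv B by simp
  have 2: "C * (Ai * B) + (D - C * Ai * B) = D"
    unfolding assoc_mult_mat[OF C Ai B, symmetric] by (rule add_minus_cancel_mat[OF CAB D])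
  have "?L * ?R = four_block_mat A B C D"
    by (subst mult_four_block_mat[of _ m m _ n _ n _ _ m _ n])
      (use A B C D Ai S 1 2 in auto)
  moreover have "det (?L * ?R) = det ?L * det ?R"
    by (rule det_mult[of _ "m + n"]) (use A S in auto)
  moreover have "det ?L = det A * det (D - C * Ai * B)"
    by (rule det_four_block_mat_upper_right_zero[OF A refl C S])
  moreover have "det ?R = 1"
    by (subst det_four_block_mat_lower_left_zero[of _ m _ n]) (use Ai B in auto)
  ultimately show ?thesis by simp
qed

text \<open>The same elimination with the other diagonal block as pivot. Both forms are needed: a rank-one
  update is computed below by comparing the two Schur complements of one bordered matrix.\<close>

lemma det_four_block_Schur_lower:
  fixes A :: "'a :: idom mat"
  assumes A: "A \<in> carrier_mat m m" and B: "B \<in> carrier_mat m n"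
    and C: "C \<in> carrier_mat n m" and D: "D \<in> carrier_mat n n"
    and Di: "Di \<in> carrier_mat n n" and inv: "D * Di = 1\<^sub>m n"
  shows "det (four_block_mat A B C D) = det D * det (A - B * Di * C)"
proof -
  let ?L = "four_block_mat (A - B * Di * C) B (0\<^sub>m n m) D"
  let ?R = "four_block_mat (1\<^sub>m m) (0\<^sub>m m n) (Di * C) (1\<^sub>m n)"
  have BDC: "B * Di * C \<in> carrier_mat m m"
    using B C Di by auto
  have S: "A - B * Di * C \<in> carrier_mat m m"
    using BDC by (rule minus_carrier_mat)
  have 1: "D * (Di * C) = C"
    using assoc_mult_mat[OF D Di C] inv C by simp
  have 2: "A - B * Di * C + B * (Di * C) = A"
    unfolding assoc_mult_mat[OF B Di C, symmetric] by (rule minus_add_cancel_mat[OF BDC A])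
  have "?L * ?R = four_block_mat A B C D"
    by (subst mult_four_block_mat[of _ m m _ n _ n _ _ m _ n])
      (use A B C D Di S 1 2 in auto)
  moreover have "det (?L * ?R) = det ?L * det ?R"
    by (rule det_mult[of _ "m + n"]) (use D S in auto)
  moreover have "det ?L = det (A - B * Di * C) * det D"
    by (rule det_four_block_mat_lower_left_zero[OF S B refl D])
  moreover have "det ?R = 1"
    by (subst det_four_block_mat_upper_right_zero[of _ m _ n]) (use Di C in auto)
  ultimately show ?thesis by simp
qed

section \<open>Constant off-diagonal blocks\<close>

definition const_mat :: "nat \<Rightarrow> nat \<Rightarrow> 'a \<Rightarrow> 'a mat" where
  "const_mat m n c = mat m n (\<lambda>_. c)"

lemma const_mat_carrier [simp]: "const_mat m n c \<in> carrier_mat m n"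
  by (simp add: const_mat_def)

definition entry_sum :: "'a :: comm_monoid_add mat \<Rightarrow> 'a" where
  "entry_sum X = (\<Sum>i<dim_row X. \<Sum>j<dim_col X. X $$ (i, j))"

text \<open>A matrix enclosed between constant matrices is only seen through the sum of its entries. This is
  what collapses every Schur complement of a constant block to a single scalar.\<close>

lemma const_mat_sandwich:
  fixes X :: "'a :: comm_semiring_1 mat"
  assumes X: "X \<in> carrier_mat m n"
  shows "const_mat p m a * X * const_mat n q b = const_mat p q (a * b * entry_sum X)"
proof (rule eq_matI)
  fix i j
  assume "i < dim_row (const_mat p q (a * b * entry_sum X))"
    and "j < dim_col (const_mat p q (a * b * entry_sum X))"
  then have ij: "i < p" "j < q"
    by (auto simp: const_mat_def)
  have "(const_mat p m a * X * const_mat n q b) $$ (i, j)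
      = (\<Sum>l<n. (\<Sum>k<m. a * X $$ (k, l)) * b)"
    using X ij by (simp add: const_mat_def scalar_prod_def atLeast0LessThan)
  also have "\<dots> = (\<Sum>l<n. \<Sum>k<m. a * b * X $$ (k, l))"
    by (simp add: sum_distrib_left sum_distrib_right mult_ac)
  also have "\<dots> = (\<Sum>k<m. \<Sum>l<n. a * b * X $$ (k, l))"
    by (rule sum.swap)
  also have "\<dots> = a * b * entry_sum X"
    using X by (simp add: entry_sum_def sum_distrib_left)
  finally show "(const_mat p m a * X * const_mat n q b) $$ (i, j)
      = const_mat p q (a * b * entry_sum X) $$ (i, j)"
    using ij by (simp add: const_mat_def)
qed (use X in \<open>auto simp: const_mat_def\<close>)

lemma entry_sum_one_mat_1 [simp]: "entry_sum (1\<^sub>m (Suc 0)) = 1"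
  by (simp add: entry_sum_def)

lemma det_bordered_const:
  fixes M :: "'a :: idom mat"
  assumes M: "M \<in> carrier_mat n n" and Mi: "Mi \<in> carrier_mat n n"
    and inv: "M * Mi = 1\<^sub>m n"
  shows "det (four_block_mat (const_mat 1 1 x) (const_mat 1 n c) (const_mat n 1 1) M)
    = det M * (x - c * entry_sum Mi)"
proof -
  have "det (four_block_mat (const_mat 1 1 x) (const_mat 1 n c) (const_mat n 1 1) M)
    = det M * det (const_mat 1 1 x - const_mat 1 n c * Mi * const_mat n 1 1)"
    by (rule det_four_block_Schur_lower[of _ 1 _ n]) (use M Mi inv in simp_all)
  also have "const_mat 1 1 x - const_mat 1 n c * Mi * const_mat n 1 1
    = const_mat 1 1 (x - c * entry_sum Mi)"
    unfolding const_mat_sandwich[OF Mi] by (auto simp: const_mat_def)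
  also have "det \<dots> = x - c * entry_sum Mi"
    by (subst det_single) (auto simp: const_mat_def)
  finally show ?thesis .
qed

text \<open>A case of the matrix determinant lemma. Border \<open>M\<close> by a row of entries \<open>c\<close>, a column of ones and
  the corner \<open>1\<close>; the Schur complement of the corner is \<open>M - const_mat n n c\<close>, while that of \<open>M\<close> is
  a scalar.\<close>

lemma det_minus_const:
  fixes M :: "'a :: idom mat"
  assumes M: "M \<in> carrier_mat n n" and Mi: "Mi \<in> carrier_mat n n"
    and inv: "M * Mi = 1\<^sub>m n"
  shows "det (M - const_mat n n c) = det M * (1 - c * entry_sum Mi)"
proof -
  have one: "const_mat 1 1 1 = (1\<^sub>m 1 :: 'a mat)"
    by (auto simp: const_mat_def)
  have "det (four_block_mat (1\<^sub>m 1) (const_mat 1 n c) (const_mat n 1 1) M)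
    = det (1\<^sub>m 1 :: 'a mat) * det (M - const_mat n 1 1 * 1\<^sub>m 1 * const_mat 1 n c)"
    by (rule det_four_block_Schur_upper[of _ 1 _ n]) (use M in simp_all)
  also have "const_mat n 1 1 * 1\<^sub>m 1 * const_mat 1 n c = const_mat n n c"
    by (subst const_mat_sandwich[of _ 1 1]) simp_all
  finally show ?thesis
    using det_bordered_const[OF M Mi inv, of 1 c] unfolding one by simp
qed

text \<open>Eliminating \<open>N\<close> turns \<open>M\<close> into \<open>M\<close> plus a constant matrix with entries \<open>entry_sum Ni\<close>, whose
  determinant the previous lemma supplies.\<close>

lemma det_four_block_const:
  fixes M N :: "'a :: idom mat"
  assumes M: "M \<in> carrier_mat m m" and Mi: "Mi \<in> carrier_mat m m"
    and invM: "M * Mi = 1\<^sub>m m"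
    and N: "N \<in> carrier_mat n n" and Ni: "Ni \<in> carrier_mat n n"
    and invN: "N * Ni = 1\<^sub>m n"
  shows "det (four_block_mat M (const_mat m n (- 1)) (const_mat n m 1) N)
    = det M * det N * (1 + entry_sum Mi * entry_sum Ni)"
proof -
  have "det (four_block_mat M (const_mat m n (- 1)) (const_mat n m 1) N)
    = det N * det (M - const_mat m n (- 1) * Ni * const_mat n m 1)"
    by (rule det_four_block_Schur_lower[of _ m _ n]) (use M N Ni invN in simp_all)
  also have "\<dots> = det N * det (M - const_mat m m (- entry_sum Ni))"
    by (simp add: const_mat_sandwich[OF Ni])
  finally show ?thesis
    by (simp add: det_minus_const[OF M Mi invM] algebra_simps)
qed

section \<open>The skew-adjacency matrix of a join\<close>

lemma vertex_of_in_verts: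
  assumes "linearly_ordered_graph G" and "i < card (verts G)"
  shows "vertex_of G (Suc i) \<in> verts G" and "label G (vertex_of G (Suc i)) = Suc i"
proof -
  have bij: "bij_betw (label G) (verts G) {1..card (verts G)}"
    using assms by (simp add: linearly_ordered_graph_def)
  then have inj: "inj_on (label G) (verts G)" and im: "Suc i \<in> label G ` verts G"
    using assms(2) by (auto simp: bij_betw_def)
  show "vertex_of G (Suc i) \<in> verts G"
    unfolding vertex_of_def by (rule the_inv_into_into[OF inj im]) simp
  show "label G (vertex_of G (Suc i)) = Suc i"
    unfolding vertex_of_def by (rule f_the_inv_into_f[OF inj im])
qed

lemma vertex_of_eqI:
  assumes "linearly_ordered_graph G" and "v \<in> verts G" and "label G v = i"
  shows "vertex_of G i = v"
  using assms unfolding vertex_of_def linearly_ordered_graph_def bij_betw_def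
  by (auto intro: the_inv_into_f_eq)

lemma vertex_of_join_left:
  assumes "linearly_ordered_graph G" and "linearly_ordered_graph H" and "i < card (verts G)"
  shows "vertex_of (ordered_join G H) (Suc i) = Inl (vertex_of G (Suc i))"
  using assms vertex_of_in_verts[OF assms(1,3)]
  by (intro vertex_of_eqI linearly_ordered_graph_join) (auto simp: ordered_join_def)

lemma vertex_of_join_right:
  assumes "linearly_ordered_graph G" and "linearly_ordered_graph H" and "i < card (verts H)"
  shows "vertex_of (ordered_join G H) (Suc (card (verts G) + i)) = Inr (vertex_of H (Suc i))"
  using assms vertex_of_in_verts[OF assms(2,3)]
  by (intro vertex_of_eqI linearly_ordered_graph_join) (auto simp: ordered_join_def)

lemma adjacent_join:
  "adjacent (ordered_join G H) (Inl u) (Inl v) \<longleftrightarrow> adjacent G u v"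
  "adjacent (ordered_join G H) (Inr w) (Inr z) \<longleftrightarrow> adjacent H w z"
  "adjacent (ordered_join G H) (Inl u) (Inr w) \<longleftrightarrow> u \<in> verts G \<and> w \<in> verts H"
  "adjacent (ordered_join G H) (Inr w) (Inl u) \<longleftrightarrow> u \<in> verts G \<and> w \<in> verts H"
  by (auto simp: adjacent_def ordered_join_def)

lemma skew_adjacency_matrix_carrier [simp]:
  "skew_adjacency_matrix G \<in> carrier_mat (card (verts G)) (card (verts G))"
  by (simp add: skew_adjacency_matrix_def)

text \<open>The labels in the join put \<open>G\<close> before \<open>H\<close>, so rows and columns split at \<open>card (verts G)\<close>. The
  off-diagonal signs record that the connecting arcs leave \<open>G\<close>.\<close>

lemma skew_adjacency_matrix_join:
  assumes G: "linearly_ordered_graph G" and H: "linearly_ordered_graph H"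
  defines "m \<equiv> card (verts G)" and "n \<equiv> card (verts H)"
  shows "skew_adjacency_matrix (ordered_join G H) =
    four_block_mat (skew_adjacency_matrix G) (const_mat m n 1)
      (const_mat n m (- 1)) (skew_adjacency_matrix H)" (is "?J = ?B")
proof -
  have card: "card (verts (ordered_join G H)) = m + n"
    using G H by (simp add: ordered_join_def linearly_ordered_graph_def card_Plus m_def n_def)
  have vl: "vertex_of (ordered_join G H) (Suc i) = Inl (vertex_of G (Suc i))" if "i < m" for i
    using vertex_of_join_left[OF G H] that by (simp add: m_def)
  have vr: "vertex_of (ordered_join G H) (Suc i) = Inr (vertex_of H (Suc (i - m)))"
    if "m \<le> i" "i < m + n" for i
    using vertex_of_join_right[OF G H, of "i - m"] that by (simp add: m_def n_def)
  show ?thesis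
  proof (rule eq_matI)
    fix i j assume "i < dim_row ?B" "j < dim_col ?B"
    then have ij: "i < m + n" "j < m + n"
      by (auto simp: skew_adjacency_matrix_def m_def n_def)
    have inG: "vertex_of G (Suc k) \<in> verts G" if "k < m" for k
      using vertex_of_in_verts(1)[OF G] that by (simp add: m_def)
    have inH: "vertex_of H (Suc k) \<in> verts H" if "k < n" for k
      using vertex_of_in_verts(1)[OF H] that by (simp add: n_def)
    show "?J $$ (i, j) = ?B $$ (i, j)"
      using ij
      by (cases "i < m"; cases "j < m")
        (auto simp: skew_adjacency_matrix_def card vl vr adjacent_join inG inH const_mat_def
          simp flip: m_def n_def)
  qed (auto simp: skew_adjacency_matrix_def card simp flip: m_def n_def)
qed

lemma poly_char_poly_eq_det:
  fixes A :: "'a :: field mat"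
  assumes "A \<in> carrier_mat n n"
  shows "poly (char_poly A) x = det (x \<cdot>\<^sub>m 1\<^sub>m n - A)"
proof -
  have "- char_matrix A x = x \<cdot>\<^sub>m 1\<^sub>m n - A"
    using assms by (auto simp: char_matrix_def)
  then show ?thesis
    using char_poly_matrix[OF assms] by simp
qed

lemma poly_skew_char_poly_join:
  assumes G: "linearly_ordered_graph G" and H: "linearly_ordered_graph H"
  defines "m \<equiv> card (verts G)" and "n \<equiv> card (verts H)"
  shows "poly (skew_char_poly (ordered_join G H)) x =
    det (four_block_mat (x \<cdot>\<^sub>m 1\<^sub>m m - skew_adjacency_matrix G) (const_mat m n (- 1))
      (const_mat n m 1) (x \<cdot>\<^sub>m 1\<^sub>m n - skew_adjacency_matrix H))"
proof -
  have A: "skew_adjacency_matrix G \<in> carrier_mat m m"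
    and B: "skew_adjacency_matrix H \<in> carrier_mat n n"
    by (simp_all add: m_def n_def)
  have J: "skew_adjacency_matrix (ordered_join G H) \<in> carrier_mat (m + n) (m + n)"
    using skew_adjacency_matrix_join[OF G H] A B by (simp flip: m_def n_def)
  have "x \<cdot>\<^sub>m 1\<^sub>m (m + n) - skew_adjacency_matrix (ordered_join G H) =
    four_block_mat (x \<cdot>\<^sub>m 1\<^sub>m m - skew_adjacency_matrix G) (const_mat m n (- 1))
      (const_mat n m 1) (x \<cdot>\<^sub>m 1\<^sub>m n - skew_adjacency_matrix H)"
    unfolding skew_adjacency_matrix_join[OF G H, folded m_def n_def]
    using A B by (auto simp: const_mat_def intro!: eq_matI)
  then show ?thesis
    using poly_char_poly_eq_det[OF J] by (simp add: skew_char_poly_def)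
qed

section \<open>The characteristic polynomial of a join\<close>

lemma right_inverse_if_det_nonzero:
  fixes A :: "'a :: field mat"
  assumes "A \<in> carrier_mat n n" and "det A \<noteq> 0"
  obtains B where "B \<in> carrier_mat n n" and "A * B = 1\<^sub>m n"
  using det_non_zero_imp_unit[OF assms, where b = undefined]
  by (auto simp: Units_def ring_mat_simps)

lemma poly_eq_if_agree_off_roots:
  fixes p q r :: "'a :: {idom, ring_char_0} poly"
  assumes r: "r \<noteq> 0" and agree: "\<And>x. poly r x \<noteq> 0 \<Longrightarrow> poly p x = poly q x"
  shows "p = q"
proof -
  have "poly ((p - q) * r) x = 0" for x
    using agree[of x] by (cases "poly r x = 0") auto
  then have "(p - q) * r = 0"
    by (simp only: poly_all_0_iff_0[symmetric] simp_thms)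
  then show ?thesis
    using r by simp
qed

lemma skew_char_poly_nonzero: "skew_char_poly G \<noteq> 0"
  using degree_monic_char_poly[OF skew_adjacency_matrix_carrier[of G]]
  by (auto simp: skew_char_poly_def)

text \<open>The value of the characteristic polynomial after joining one vertex determines the entry sum of
  the inverse of \<open>xI - A\<close>; this is how the scalar of \<open>det_four_block_const\<close> gets its graph-theoretic
  meaning.\<close>

lemma poly_skew_char_poly_K1_join:
  assumes G: "linearly_ordered_graph G"
  defines "m \<equiv> card (verts G)"
  assumes Mi: "Mi \<in> carrier_mat m m"
    and inv: "(x \<cdot>\<^sub>m 1\<^sub>m m - skew_adjacency_matrix G) * Mi = 1\<^sub>m m"
  shows "poly (skew_char_poly (ordered_join K1 G)) x
    = poly (skew_char_poly G) x * (x + entry_sum Mi)"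
proof -
  have A: "skew_adjacency_matrix G \<in> carrier_mat m m"
    by (simp add: m_def)
  have K1: "card (verts K1) = 1"
    by (simp add: K1_def)
  have corner: "x \<cdot>\<^sub>m 1\<^sub>m 1 - skew_adjacency_matrix K1 = const_mat 1 1 x"
    by (auto simp: skew_adjacency_matrix_def const_mat_def K1 intro!: eq_matI)
  have "poly (skew_char_poly (ordered_join K1 G)) x =
    det (four_block_mat (const_mat 1 1 x) (const_mat 1 m (- 1)) (const_mat m 1 1)
      (x \<cdot>\<^sub>m 1\<^sub>m m - skew_adjacency_matrix G))"
    using poly_skew_char_poly_join[OF linearly_ordered_graph_K1 G, of x]
    by (simp only: K1 corner m_def)
  also have "\<dots> = det (x \<cdot>\<^sub>m 1\<^sub>m m - skew_adjacency_matrix G) * (x + entry_sum Mi)"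
    using det_bordered_const[OF minus_carrier_mat[OF A] Mi inv, of x "- 1"] by simp
  also have "det (x \<cdot>\<^sub>m 1\<^sub>m m - skew_adjacency_matrix G) = poly (skew_char_poly G) x"
    by (simp add: skew_char_poly_def poly_char_poly_eq_det[OF A])
  finally show ?thesis .
qed

theorem theorem9:
  fixes G :: "'a ordered_graph" and H :: "'b ordered_graph"
  assumes "linearly_ordered_graph G" and "verts G \<noteq> {}"
    and "linearly_ordered_graph H" and "verts H \<noteq> {}"
  shows "skew_char_poly (ordered_join G H) =
    skew_char_poly G * skew_char_poly H +
    (skew_char_poly (ordered_join K1 G) - [:0, 1:] * skew_char_poly G) *
    (skew_char_poly (ordered_join K1 H) - [:0, 1:] * skew_char_poly H)"
    (is "?lhs = ?rhs")
proof -
  let ?P = "skew_char_poly G" and ?Q = "skew_char_poly H"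
  note G = assms(1) and H = assms(3)
  have agree: "poly ?lhs x = poly ?rhs x" if P: "poly ?P x \<noteq> 0" and Q: "poly ?Q x \<noteq> 0" for x
  proof -
    define m where "m = card (verts G)"
    define n where "n = card (verts H)"
    define M where "M = x \<cdot>\<^sub>m 1\<^sub>m m - skew_adjacency_matrix G"
    define N where "N = x \<cdot>\<^sub>m 1\<^sub>m n - skew_adjacency_matrix H"
    have M: "M \<in> carrier_mat m m" and N: "N \<in> carrier_mat n n"
      unfolding M_def N_def m_def n_def by (intro minus_carrier_mat skew_adjacency_matrix_carrier)+
    have PM: "poly ?P x = det M" and QN: "poly ?Q x = det N"
      by (simp_all add: skew_char_poly_def M_def N_def m_def n_def
          poly_char_poly_eq_det[OF skew_adjacency_matrix_carrier])
    obtain Mi where Mi: "Mi \<in> carrier_mat m m" "M * Mi = 1\<^sub>m m"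
      using right_inverse_if_det_nonzero[OF M] P PM by auto
    obtain Ni where Ni: "Ni \<in> carrier_mat n n" "N * Ni = 1\<^sub>m n"
      using right_inverse_if_det_nonzero[OF N] Q QN by auto
    have "poly ?lhs x = det M * det N * (1 + entry_sum Mi * entry_sum Ni)"
      using poly_skew_char_poly_join[OF G H, of x] det_four_block_const[OF M Mi N Ni]
      by (simp add: M_def N_def m_def n_def)
    moreover have "poly (skew_char_poly (ordered_join K1 G)) x = det M * (x + entry_sum Mi)"
      using poly_skew_char_poly_K1_join[OF G, of Mi x] Mi
      by (simp add: PM flip: m_def M_def)
    moreover have "poly (skew_char_poly (ordered_join K1 H)) x = det N * (x + entry_sum Ni)"
      using poly_skew_char_poly_K1_join[OF H, of Ni x] Ni
      by (simp add: QN flip: n_def N_def)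
    ultimately show ?thesis
      by (simp add: PM QN algebra_simps)
  qed
  show ?thesis
  proof (rule poly_eq_if_agree_off_roots)
    show "?P * ?Q \<noteq> 0"
      by (simp add: skew_char_poly_nonzero)
    show "poly ?lhs x = poly ?rhs x" if "poly (?P * ?Q) x \<noteq> 0" for x
      using that by (intro agree) auto
  qed
qed

end
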